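(* Let $\mathcal{E}\colon\mathcal{M}\to\mathbb{R}$ be an energy functional possessing an $L^2$ first variation $\frac{\delta}{\delta u}\mathcal{E}(u)\in C^\infty(\Omega)$ at every $u\in\mathcal{M}$. Then the gradient flow $\partial_t u=-\mathrm{grad}\,\mathcal{E}(u)$ of $\mathcal{E}$ in $(\mathcal{M},g)$ is $$\partial_t u(t,x)=\nabla\cdot\Big(V_1(u)\nabla\frac{\delta}{\delta u}\mathcal{E}(u)\Big)(t,x)-V_2(u)\frac{\delta}{\delta u}\mathcal{E}(u)(t,x).$$ If moreover $\mathcal{E}(u)=\mathcal{G}(u)=\int_\Omega G(u(x))\,dx$, then this equation is the reaction-diffusion equation $$\partial_t u(t,x)=\Delta F(u(t,x))+R(u(t,x)).$$
   Context: $\Omega\subset\mathbb{R}^d$ is a compact convex spatial domain with periodic boundary conditions (a box with opposite faces identified), so functions in $C^\infty(\Omega)$ are smooth and periodic and integration by parts produces no boundary terms. $F,G,R$ are smooth real functions on $(0,\infty)$ with $F'(u)>0$ and $G''(u)>0$ for $u>0$. Set $V_1(u)=\frac{F'(u)}{G''(u)}$ and $V_2(u)=-\frac{R(u)}{G'(u)}$, where $V_2$ is understood as a smooth positive function on $(0,\infty)$ with $V_2G'=-R$. $\mathcal{M}=\{u\in C^\infty(\Omega): u>0\}$ is the smooth positive density space, with tangent space $T_u\mathcal{M}=C^\infty(\Omega)$ at every $u\in\mathcal{M}$. The mean-field information metric is the inner product on $T_u\mathcal{M}$ given by $$g(u)(\sigma_1,\sigma_2)=\int_\Omega \sigma_1\Big(-\nabla\cdot(V_1(u)\nabla)+V_2(u)\Big)^{-1}\sigma_2\,dx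 .$$ The $L^2$ first variation $\frac{\delta}{\delta u}\mathcal{E}(u)$ is defined by $\frac{d}{d\epsilon}\big|_{\epsilon=0}\mathcal{E}(u+\epsilon\sigma)=\int_\Omega \frac{\delta}{\delta u}\mathcal{E}(u)(x)\,\sigma(x)\,dx$ for all $\sigma\in C^\infty(\Omega)$. The gradient $\mathrm{grad}\,\mathcal{E}(u)\in T_u\mathcal{M}$ is defined by $g(u)(\sigma,\mathrm{grad}\,\mathcal{E}(u))=\int_\Omega\frac{\delta}{\delta u}\mathcal{E}(u)\,\sigma\,dx$ for all $\sigma\in T_u\mathcal{M}$. *)

theory Defs
  imports "HOL-Analysis.Analysis"
begin

text \<open>
  The spatial domain is the box \<open>cbox a b\<close> with opposite faces identified.  Functions on it are
  represented by functions on the whole Euclidean space \<open>'a\<close> that are periodic with period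
  \<open>(b - a) \<bullet> i\<close> in every coordinate direction \<open>i\<close>; integrals are taken over \<open>cbox a b\<close>.
\<close>

definition partial :: "'a::euclidean_space \<Rightarrow> ('a \<Rightarrow> real) \<Rightarrow> 'a \<Rightarrow> real" where
  "partial i f = (\<lambda>x. frechet_derivative f (at x) i)"

definition grad :: "('a::euclidean_space \<Rightarrow> real) \<Rightarrow> 'a \<Rightarrow> 'a" where
  "grad f = (\<lambda>x. \<Sum>i\<in>Basis. partial i f x *\<^sub>R i)"

definition div_field :: "('a::euclidean_space \<Rightarrow> 'a) \<Rightarrow> 'a \<Rightarrow> real" where
  "div_field X = (\<lambda>x. \<Sum>i\<in>Basis. partial i (\<lambda>y. X y \<bullet> i) x)"

definition laplacian :: "('a::euclidean_space \<Rightarrow> real) \<Rightarrow> 'a \<Rightarrow> real" where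
  "laplacian f = div_field (grad f)"

text \<open>
  Smoothness means that every iterated partial derivative is again (Frechet) differentiable; the
  list \<open>is\<close> records the directions of the successive derivatives.
\<close>

definition smooth :: "('a::euclidean_space \<Rightarrow> real) \<Rightarrow> bool" where
  "smooth f \<longleftrightarrow> (\<forall>is\<in>lists Basis. \<forall>x. foldr partial is f differentiable (at x))"

definition smooth_pos :: "(real \<Rightarrow> real) \<Rightarrow> bool" where
  "smooth_pos h \<longleftrightarrow> (\<forall>k. \<forall>r>0. (deriv ^^ k) h differentiable (at r))"

definition C_inf :: "'a::euclidean_space \<Rightarrow> 'a \<Rightarrow> ('a \<Rightarrow> real) set" where
  "C_inf a b = {f. smooth f \<and> (\<forall>i\<in>Basis. \<forall>x. f (x + ((b - a) \<bullet> i) *\<^sub>R i) = f x)}"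

definition density_space :: "'a::euclidean_space \<Rightarrow> 'a \<Rightarrow> ('a \<Rightarrow> real) set" where
  "density_space a b = {u \<in> C_inf a b. \<forall>x. 0 < u x}"

definition mf_operator ::
  "(real \<Rightarrow> real) \<Rightarrow> (real \<Rightarrow> real) \<Rightarrow> ('a::euclidean_space \<Rightarrow> real) \<Rightarrow> ('a \<Rightarrow> real) \<Rightarrow> 'a \<Rightarrow> real"
  where
  "mf_operator V1 V2 u \<phi> =
     (\<lambda>x. - div_field (\<lambda>y. V1 (u y) *\<^sub>R grad \<phi> y) x + V2 (u x) * \<phi> x)"

text \<open>
  The inverse of the operator on the smooth periodic functions is rendered as a partial map,
  defined at \<open>\<sigma>\<close> when the elliptic equation with right-hand side \<open>\<sigma>\<close> has exactly one smooth
  periodic solution.  The metric is accordingly option-valued, so that an equation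
  \<open>mf_metric \<dots> = Some r\<close> says that the metric is defined there and has the value \<open>r\<close>.
  A total inverse would take unspecified values off the range of the operator.  For smooth positive
  \<open>V1\<close> and \<open>V2\<close> elliptic theory makes the map total on \<open>C_inf a b\<close>.
\<close>

definition mf_inverse ::
  "'a::euclidean_space \<Rightarrow> 'a \<Rightarrow> (real \<Rightarrow> real) \<Rightarrow> (real \<Rightarrow> real) \<Rightarrow> ('a \<Rightarrow> real) \<Rightarrow>
    (('a \<Rightarrow> real) \<rightharpoonup> ('a \<Rightarrow> real))" where
  "mf_inverse a b V1 V2 u \<sigma> =
     (if \<exists>!\<phi>. \<phi> \<in> C_inf a b \<and> mf_operator V1 V2 u \<phi> = \<sigma>
      then Some (THE \<phi>. \<phi> \<in> C_inf a b \<and> mf_operator V1 V2 u \<phi> = \<sigma>)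
      else None)"

definition mf_metric ::
  "'a::euclidean_space \<Rightarrow> 'a \<Rightarrow> (real \<Rightarrow> real) \<Rightarrow> (real \<Rightarrow> real) \<Rightarrow> ('a \<Rightarrow> real) \<Rightarrow>
    ('a \<Rightarrow> real) \<Rightarrow> ('a \<Rightarrow> real) \<Rightarrow> real option" where
  "mf_metric a b V1 V2 u \<sigma>1 \<sigma>2 =
     map_option (\<lambda>\<phi>. integral (cbox a b) (\<lambda>x. \<sigma>1 x * \<phi> x)) (mf_inverse a b V1 V2 u \<sigma>2)"

text \<open>
  Functionals on the density space are total HOL functions.  Their values outside the density space
  play no role below: if \<open>u\<close> is in the density space and \<open>\<sigma>\<close> in \<open>C_inf a b\<close>, then \<open>u + \<epsilon> \<sigma>\<close> is in the
  density space for all small \<open>\<epsilon>\<close>, by compactness.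
\<close>

definition has_first_variation ::
  "'a::euclidean_space \<Rightarrow> 'a \<Rightarrow> (('a \<Rightarrow> real) \<Rightarrow> real) \<Rightarrow> ('a \<Rightarrow> real) \<Rightarrow> ('a \<Rightarrow> real) \<Rightarrow> bool"
  where
  "has_first_variation a b E u \<xi> \<longleftrightarrow> \<xi> \<in> C_inf a b \<and>
     (\<forall>\<sigma>\<in>C_inf a b. ((\<lambda>\<epsilon>. E (\<lambda>x. u x + \<epsilon> * \<sigma> x)) has_real_derivative
        integral (cbox a b) (\<lambda>x. \<xi> x * \<sigma> x)) (at 0))"

definition first_variation ::
  "'a::euclidean_space \<Rightarrow> 'a \<Rightarrow> (('a \<Rightarrow> real) \<Rightarrow> real) \<Rightarrow> ('a \<Rightarrow> real) \<Rightarrow> 'a \<Rightarrow> real" where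
  "first_variation a b E u = (THE \<xi>. has_first_variation a b E u \<xi>)"

definition is_mf_gradient ::
  "'a::euclidean_space \<Rightarrow> 'a \<Rightarrow> (real \<Rightarrow> real) \<Rightarrow> (real \<Rightarrow> real) \<Rightarrow> (('a \<Rightarrow> real) \<Rightarrow> real) \<Rightarrow>
    ('a \<Rightarrow> real) \<Rightarrow> ('a \<Rightarrow> real) \<Rightarrow> bool" where
  "is_mf_gradient a b V1 V2 E u h \<longleftrightarrow> h \<in> C_inf a b \<and>
     (\<forall>\<sigma>\<in>C_inf a b. mf_metric a b V1 V2 u \<sigma> h =
        Some (integral (cbox a b) (\<lambda>x. first_variation a b E u x * \<sigma> x)))"

definition gradient_flow_at ::
  "'a::euclidean_space \<Rightarrow> 'a \<Rightarrow> (real \<Rightarrow> real) \<Rightarrow> (real \<Rightarrow> real) \<Rightarrow> (('a \<Rightarrow> real) \<Rightarrow> real) \<Rightarrow>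
    real set \<Rightarrow> (real \<Rightarrow> 'a \<Rightarrow> real) \<Rightarrow> real \<Rightarrow> bool" where
  "gradient_flow_at a b V1 V2 E I u t \<longleftrightarrow>
     (\<exists>h. is_mf_gradient a b V1 V2 E (u t) h \<and>
          (\<forall>x. ((\<lambda>s. u s x) has_real_derivative - h x) (at t within I)))"

end

theory Submission
  imports Defs
begin

text \<open>
  Let \<open>L\<close> be the elliptic operator whose inverse defines the metric, and \<open>\<xi>\<close> the first variation
  at \<open>u\<close>.  Testing the gradient identity with all smooth periodic functions identifies
  \<open>L\<^sup>-\<^sup>1 (grad E)\<close> with \<open>\<xi>\<close>, so \<open>grad E = L \<xi>\<close>.  The converse needs no existence theory for \<open>L\<close>: the
  equation \<open>L \<phi> = L \<xi>\<close> is solved by \<open>\<xi>\<close>, and by the maximum principle by nothing else.  For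
  \<open>E u = \<integral> G(u)\<close> the first variation is \<open>G' \<circ> u\<close>, and \<open>V1 G'' = F'\<close>, \<open>V2 G' = - R\<close> turn the
  right-hand side into \<open>\<Delta> F(u) + R(u)\<close>.
\<close>

section \<open>Calculus of partial derivatives\<close>

lemma partial_eq:
  assumes "(f has_derivative D) (at x)"
  shows "partial i f x = D i"
  unfolding partial_def using frechet_derivative_at[OF assms] by simp

lemma partial_has_derivative:
  assumes "f differentiable (at x)"
  shows "(f has_derivative (\<lambda>h. frechet_derivative f (at x) h)) (at x)"
  using assms frechet_derivative_works by blast

lemma partial_add:
  assumes "f differentiable (at x)" "g differentiable (at x)"
  shows "partial i (\<lambda>y. f y + g y) x = partial i f x + partial i g x"
  using partial_eq[OF has_derivative_add[OF assms[THEN partial_has_derivative]]]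
  by (simp add: partial_def)

lemma partial_mult:
  assumes "f differentiable (at x)" "g differentiable (at x)"
  shows "partial i (\<lambda>y. f y * g y) x = partial i f x * g x + f x * partial i g x"
  using partial_eq[OF has_derivative_mult[OF assms[THEN partial_has_derivative]]]
  by (simp add: partial_def)

lemma partial_compose:
  assumes "h differentiable (at (g x))" "g differentiable (at x)"
  shows "partial i (\<lambda>y. h (g y)) x = deriv h (g x) * partial i g x"
proof -
  have "(h has_real_derivative deriv h (g x)) (at (g x))"
    using assms(1) DERIV_deriv_iff_real_differentiable by blast
  from partial_eq[OF DERIV_compose_FDERIV[OF this partial_has_derivative[OF assms(2)]]]
  show ?thesis by (simp add: partial_def)
qed

lemma differentiable_real_compose:
  fixes h :: "real \<Rightarrow> real"
  assumes "h differentiable (at (g x))" "g differentiable (at x)"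
  shows "(\<lambda>y. h (g y)) differentiable (at x)"
  using differentiable_chain_at[OF assms(2,1)] by (simp add: o_def)

section \<open>Smooth functions and their closure properties\<close>

lemma smooth_differentiable: "smooth f \<Longrightarrow> f differentiable (at x)"
  unfolding smooth_def by (drule bspec[of _ _ "[]"]) auto

lemma smooth_partial:
  assumes "smooth f" "i \<in> Basis"
  shows "smooth (partial i f)"
  unfolding smooth_def
proof (intro ballI allI)
  fix "is" :: "'a list" and x
  assume "is \<in> lists Basis"
  \<comment> \<open>\<open>foldr\<close> applies the last entry first, so the initial derivative in
    direction \<open>i\<close> is recorded at the end of the list.\<close>
  then have "is @ [i] \<in> lists Basis" using assms(2) by auto
  then have "foldr partial (is @ [i]) f differentiable at x"
    using assms(1) unfolding smooth_def by blast
  then show "foldr partial is (partial i f) differentiable at x" by simp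
qed

text \<open>Induction on the list of directions: iterated partial derivatives never leave
  \<open>X\<close>. This replaces product and chain formulas of higher order.\<close>

lemma smooth_coinduct:
  assumes "f \<in> X"
    and diff: "\<And>f x. f \<in> X \<Longrightarrow> f differentiable (at x)"
    and part: "\<And>f i. f \<in> X \<Longrightarrow> i \<in> Basis \<Longrightarrow> partial i f \<in> X"
  shows "smooth f"
proof -
  have "foldr partial is g \<in> X" if "is \<in> lists Basis" "g \<in> X" for "is" g
    using that by (induction "is") (auto intro: part)
  then show ?thesis unfolding smooth_def using assms(1) diff by blast
qed

lemma smooth_pos_differentiable: "smooth_pos h \<Longrightarrow> r > 0 \<Longrightarrow> h differentiable (at r)"
  unfolding smooth_pos_def by (drule spec[of _ 0]) auto

lemma smooth_pos_deriv:
  assumes "smooth_pos h"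
  shows "smooth_pos (deriv h)"
proof -
  have "(deriv ^^ k) (deriv h) = (deriv ^^ Suc k) h" for k
    by (simp add: funpow_swap1)
  then show ?thesis using assms unfolding smooth_pos_def by metis
qed

text \<open>Since this set consists of differentiable functions and is closed under partial derivatives,
  all its members are smooth.  This gives every closure property of smooth functions at once.\<close>

inductive_set smooth_algebra :: "('a::euclidean_space \<Rightarrow> real) set" where
  base: "smooth f \<Longrightarrow> f \<in> smooth_algebra"
| const: "(\<lambda>x. c) \<in> smooth_algebra"
| comp: "smooth_pos h \<Longrightarrow> smooth g \<Longrightarrow> (\<And>x. 0 < g x) \<Longrightarrow> (\<lambda>x. h (g x)) \<in> smooth_algebra"
| add: "f \<in> smooth_algebra \<Longrightarrow> g \<in> smooth_algebra \<Longrightarrow> (\<lambda>x. f x + g x) \<in> smooth_algebra"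
| mult: "f \<in> smooth_algebra \<Longrightarrow> g \<in> smooth_algebra \<Longrightarrow> (\<lambda>x. f x * g x) \<in> smooth_algebra"
| inverse: "f \<in> smooth_algebra \<Longrightarrow> (\<And>x. f x \<noteq> 0) \<Longrightarrow> (\<lambda>x. inverse (f x)) \<in> smooth_algebra"

lemma smooth_algebra_differentiable: "f \<in> smooth_algebra \<Longrightarrow> f differentiable (at x)"
proof (induction rule: smooth_algebra.induct)
  case (comp h g)
  then show ?case
    using differentiable_real_compose[of h g x] smooth_pos_differentiable smooth_differentiable by blast
next
  case (inverse f)
  then show ?case by (intro differentiable_inverse)
qed (auto intro: smooth_differentiable)

lemma partial_const: "partial i (\<lambda>x. c) = (\<lambda>x. 0)"
  by (rule ext) (simp add: partial_eq[OF has_derivative_const])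

text \<open>The right-hand side uses only a constant, products and \<open>inverse\<close>, so that
  it can be rebuilt with the constructors of \<open>smooth_algebra\<close>.\<close>

lemma partial_inverse:
  assumes "f differentiable (at x)" "f x \<noteq> 0"
  shows "partial i (\<lambda>y. inverse (f y)) x = - 1 * (inverse (f x) * inverse (f x)) * partial i f x"
  using partial_eq[OF Deriv.has_derivative_inverse[OF assms(2) partial_has_derivative[OF assms(1)]]]
  by (simp add: partial_def)

lemma smooth_algebra_partial: "f \<in> smooth_algebra \<Longrightarrow> i \<in> Basis \<Longrightarrow> partial i f \<in> smooth_algebra"
proof (induction rule: smooth_algebra.induct)
  case (base f)
  then show ?case by (intro smooth_algebra.base smooth_partial)
next
  case (const c)
  then show ?case by (simp add: partial_const smooth_algebra.const)
next
  case (comp h g)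
  have "partial i (\<lambda>x. h (g x)) = (\<lambda>x. deriv h (g x) * partial i g x)"
    using partial_compose[of h g] comp smooth_pos_differentiable smooth_differentiable by blast
  \<comment> \<open>\<open>deriv h\<close> is again smooth on the positive reals, so the outer
    factor has the form \<open>comp\<close> with the same inner function.\<close>
  moreover have "(\<lambda>x. deriv h (g x)) \<in> smooth_algebra"
    by (intro smooth_algebra.comp smooth_pos_deriv comp)
  ultimately show ?case
    using comp by (simp add: smooth_algebra.mult smooth_algebra.base smooth_partial)
next
  case (add f g)
  then have "partial i (\<lambda>x. f x + g x) = (\<lambda>x. partial i f x + partial i g x)"
    by (intro ext partial_add smooth_algebra_differentiable)
  then show ?case using add by (simp add: smooth_algebra.add)
next
  case (mult f g)
  then have "partial i (\<lambda>x. f x * g x) = (\<lambda>x. partial i f x * g x + f x * partial i g x)"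
    by (intro ext partial_mult smooth_algebra_differentiable)
  then show ?case using mult by (simp add: smooth_algebra.add smooth_algebra.mult)
next
  case (inverse f)
  then have "partial i (\<lambda>x. inverse (f x))
      = (\<lambda>x. - 1 * (inverse (f x) * inverse (f x)) * partial i f x)"
    by (intro ext partial_inverse smooth_algebra_differentiable)
  moreover have "(\<lambda>x. inverse (f x)) \<in> smooth_algebra"
    by (rule smooth_algebra.inverse) (use inverse in auto)
  ultimately show ?case
    using inverse by (auto simp only: intro!: smooth_algebra.mult[OF smooth_algebra.mult]
        smooth_algebra.mult smooth_algebra.const)
qed

lemma smooth_algebra_smooth: "f \<in> smooth_algebra \<Longrightarrow> smooth f"
  by (rule smooth_coinduct[of _ smooth_algebra])
    (auto intro: smooth_algebra_differentiable smooth_algebra_partial)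

lemma smooth_const: "smooth (\<lambda>x. c)"
  by (rule smooth_algebra_smooth[OF smooth_algebra.const])

lemma smooth_add: "smooth f \<Longrightarrow> smooth g \<Longrightarrow> smooth (\<lambda>x. f x + g x)"
  by (rule smooth_algebra_smooth[OF smooth_algebra.add[OF smooth_algebra.base smooth_algebra.base]])

lemma smooth_mult: "smooth f \<Longrightarrow> smooth g \<Longrightarrow> smooth (\<lambda>x. f x * g x)"
  by (rule smooth_algebra_smooth[OF smooth_algebra.mult[OF smooth_algebra.base smooth_algebra.base]])

lemma smooth_inverse: "smooth f \<Longrightarrow> (\<And>x. f x \<noteq> 0) \<Longrightarrow> smooth (\<lambda>x. inverse (f x))"
  by (rule smooth_algebra_smooth[OF smooth_algebra.inverse[OF smooth_algebra.base]])

lemma smooth_compose: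
  "smooth_pos h \<Longrightarrow> smooth g \<Longrightarrow> (\<And>x. 0 < g x) \<Longrightarrow> smooth (\<lambda>x. h (g x))"
  by (rule smooth_algebra_smooth[OF smooth_algebra.comp])

lemma smooth_continuous: "smooth f \<Longrightarrow> continuous_on S f"
  by (meson smooth_differentiable continuous_at_imp_continuous_on differentiable_imp_continuous_within)

section \<open>Smooth periodic functions\<close>

lemma C_infD:
  assumes "f \<in> C_inf a b"
  shows "smooth f" "\<And>i x. i \<in> Basis \<Longrightarrow> f (x + ((b - a) \<bullet> i) *\<^sub>R i) = f x"
  using assms by (auto simp: C_inf_def)

lemma C_infI:
  assumes "smooth f" "\<And>i x. i \<in> Basis \<Longrightarrow> f (x + ((b - a) \<bullet> i) *\<^sub>R i) = f x"
  shows "f \<in> C_inf a b"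
  using assms by (auto simp: C_inf_def)

lemma C_inf_const: "(\<lambda>x. c) \<in> C_inf a b"
  by (intro C_infI smooth_const) simp

lemma C_inf_add: "f \<in> C_inf a b \<Longrightarrow> g \<in> C_inf a b \<Longrightarrow> (\<lambda>x. f x + g x) \<in> C_inf a b"
  by (simp add: C_inf_def smooth_add)

lemma C_inf_mult: "f \<in> C_inf a b \<Longrightarrow> g \<in> C_inf a b \<Longrightarrow> (\<lambda>x. f x * g x) \<in> C_inf a b"
  by (simp add: C_inf_def smooth_mult)

lemma C_inf_inverse:
  "f \<in> C_inf a b \<Longrightarrow> (\<And>x. f x \<noteq> 0) \<Longrightarrow> (\<lambda>x. inverse (f x)) \<in> C_inf a b"
  by (simp add: C_inf_def smooth_inverse)

lemma C_inf_diff: "f \<in> C_inf a b \<Longrightarrow> g \<in> C_inf a b \<Longrightarrow> (\<lambda>x. f x - g x) \<in> C_inf a b"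
  using C_inf_add[OF _ C_inf_mult[OF C_inf_const[of "- 1"]]] by fastforce

lemma C_inf_sum:
  "(\<And>i. i \<in> S \<Longrightarrow> f i \<in> C_inf a b) \<Longrightarrow> (\<lambda>x. \<Sum>i\<in>S. f i x) \<in> C_inf a b"
  by (induction S rule: infinite_finite_induct) (auto intro: C_inf_const C_inf_add)

lemma density_spaceD:
  assumes "u \<in> density_space a b"
  shows "u \<in> C_inf a b" "0 < u x"
  using assms by (auto simp: density_space_def)

lemma C_inf_compose:
  assumes "smooth_pos h" "u \<in> density_space a b"
  shows "(\<lambda>x. h (u x)) \<in> C_inf a b"
proof -
  note u = density_spaceD[OF assms(2)]
  show ?thesis
    using smooth_compose[OF assms(1) C_infD(1)[OF u(1)] u(2)] C_infD(2)[OF u(1)]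
    by (simp add: C_inf_def)
qed

text \<open>Translation by a period leaves \<open>f\<close> unchanged, so the derivative of
  \<open>f\<close> at the translated point is also its derivative at the original one.\<close>

lemma C_inf_partial:
  assumes "f \<in> C_inf a b" "i \<in> Basis"
  shows "partial i f \<in> C_inf a b"
proof (rule C_infI)
  note f = C_infD[OF assms(1)]
  show "smooth (partial i f)" using smooth_partial[OF f(1) assms(2)] .
  fix j x assume j: "j \<in> (Basis :: 'a set)"
  let ?c = "((b - a) \<bullet> j) *\<^sub>R j"
  have "(f has_derivative frechet_derivative f (at (x + ?c))) (at (x + ?c))"
    using smooth_differentiable[OF f(1)] partial_has_derivative by blast
  moreover have "((\<lambda>y. y + ?c) has_derivative (\<lambda>h. h)) (at x)"
    by (auto intro!: derivative_eq_intros)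
  ultimately have "((\<lambda>y. f (y + ?c)) has_derivative frechet_derivative f (at (x + ?c))) (at x)"
    using has_derivative_compose[of "\<lambda>y. y + ?c" "\<lambda>h. h" x UNIV f] by auto
  then have "(f has_derivative frechet_derivative f (at (x + ?c))) (at x)"
    using f(2)[OF j] by simp
  from partial_eq[OF this, of i] show "partial i f (x + ?c) = partial i f x"
    by (simp add: partial_def)
qed

lemma C_inf_int_shift:
  assumes "f \<in> C_inf a b" "i \<in> Basis"
  shows "f (x + (of_int k * ((b - a) \<bullet> i)) *\<^sub>R i) = f x"
proof (induction k rule: int_induct[where k = 0])
  case base
  show ?case by simp
next
  case (step1 k)
  then show ?case
    using C_infD(2)[OF assms, of "x + (of_int k * ((b - a) \<bullet> i)) *\<^sub>R i"]
    by (simp add: algebra_simps)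
next
  case (step2 k)
  \<comment> \<open>Downwards, the period relation is used at the point shifted by
    \<open>k - 1\<close>, one period below the known one.\<close>
  then show ?case
    using C_infD(2)[OF assms, of "x + (of_int (k - 1) * ((b - a) \<bullet> i)) *\<^sub>R i"]
    by (simp add: algebra_simps)
qed

lemma C_inf_lattice_shift:
  assumes "f \<in> C_inf a b" "S \<subseteq> Basis"
  shows "f (x + (\<Sum>i\<in>S. (of_int (k i) * ((b - a) \<bullet> i)) *\<^sub>R i)) = f x"
proof -
  have "finite S" using assms(2) finite_subset finite_Basis by blast
  then show ?thesis using assms(2)
  proof (induction S)
    case (insert j S)
    then show ?case
      using C_inf_int_shift[OF assms(1), of j "x + (\<Sum>i\<in>S. (of_int (k i) * ((b - a) \<bullet> i)) *\<^sub>R i)" "k j"]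
      by (simp add: ac_simps)
  qed simp
qed

text \<open>Removing the integer number of periods in each coordinate moves \<open>x\<close> into
  the box. A single \<open>y\<close> serves all \<open>f\<close>, so facts on the box pass to the
  whole space.\<close>

lemma fundamental_domain:
  fixes a b :: "'a::euclidean_space"
  assumes box: "\<And>i. i \<in> Basis \<Longrightarrow> a \<bullet> i < b \<bullet> i"
  obtains y where "y \<in> cbox a b" "\<And>f. f \<in> C_inf a b \<Longrightarrow> f y = f x"
proof
  define L where "L i = (b - a) \<bullet> i" for i
  define k where "k i = - \<lfloor>((x - a) \<bullet> i) / L i\<rfloor>" for i
  define y where "y = x + (\<Sum>i\<in>Basis. (of_int (k i) * L i) *\<^sub>R i)"
  have "a \<bullet> i \<le> y \<bullet> i \<and> y \<bullet> i \<le> b \<bullet> i" if i: "i \<in> Basis" for i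
  proof -
    have L: "L i > 0" using box[OF i] by (simp add: L_def inner_diff_left)
    have "y \<bullet> i = x \<bullet> i - of_int \<lfloor>((x - a) \<bullet> i) / L i\<rfloor> * L i"
      using i by (simp add: y_def k_def inner_add_left inner_sum_left inner_Basis if_distrib cong: if_cong)
    \<comment> \<open>A quotient lies between its floor and its floor plus one; multiplied by
      \<open>L i > 0\<close>, these bounds are the two sides of the box condition.\<close>
    moreover have "of_int \<lfloor>((x - a) \<bullet> i) / L i\<rfloor> * L i \<le> (x - a) \<bullet> i"
      using L by (simp flip: pos_le_divide_eq)
    moreover have "(x - a) \<bullet> i \<le> (of_int \<lfloor>((x - a) \<bullet> i) / L i\<rfloor> + 1) * L i"
      using L by (simp flip: pos_divide_le_eq) 
    ultimately show ?thesis by (simp add: L_def inner_diff_left algebra_simps)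
  qed
  then show "y \<in> cbox a b" by (simp add: mem_box)
  show "f y = f x" if "f \<in> C_inf a b" for f
    using C_inf_lattice_shift[OF that order_refl] by (simp add: y_def L_def)
qed

section \<open>Testing against smooth periodic functions\<close>

text \<open>A continuous nonnegative function with zero integral vanishes on the box, and
  periodicity carries this to every point.\<close>

lemma integral_square_eq_0:
  fixes a b :: "'a::euclidean_space"
  assumes box: "\<And>i. i \<in> Basis \<Longrightarrow> a \<bullet> i < b \<bullet> i"
    and f: "f \<in> C_inf a b" and int: "integral (cbox a b) (\<lambda>x. f x * f x) = 0"
  shows "f = (\<lambda>x. 0)"
proof
  fix x
  obtain y where y: "y \<in> cbox a b" "f y = f x"
    using fundamental_domain[OF box] f by metis
  have cont: "continuous_on (cbox a b) (\<lambda>x. f x * f x)"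
    by (intro continuous_intros smooth_continuous C_infD(1)[OF f])
  have "((\<lambda>x. f x * f x) has_integral 0) (cbox a b)"
    using int integrable_continuous[OF cont] by (metis integrable_integral)
  \<comment> \<open>A degenerate box has measure zero, and a vanishing integral over it would say
    nothing about \<open>f\<close>.\<close>
  moreover have "box a b \<noteq> {}" using box by (simp add: box_ne_empty)
  ultimately have "f y * f y = 0"
    using has_integral_0_cbox_imp_0[OF cont] y(1) by (meson zero_le_square)
  then show "f x = 0" using y(2) by simp
qed

text \<open>The difference of \<open>f\<close> and \<open>g\<close> is itself an admissible test
  function, and testing with it yields the integral of its square. No bump functions are
  involved.\<close>

lemma integral_test_eq:
  fixes a b :: "'a::euclidean_space"
  assumes box: "\<And>i. i \<in> Basis \<Longrightarrow> a \<bullet> i < b \<bullet> i"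
    and f: "f \<in> C_inf a b" and g: "g \<in> C_inf a b"
    and eq: "\<And>\<sigma>. \<sigma> \<in> C_inf a b \<Longrightarrow>
      integral (cbox a b) (\<lambda>x. f x * \<sigma> x) = integral (cbox a b) (\<lambda>x. g x * \<sigma> x)"
  shows "f = g"
proof -
  define d where "d x = f x - g x" for x
  have d: "d \<in> C_inf a b" unfolding d_def by (rule C_inf_diff[OF f g])
  have int: "(\<lambda>x. p x * d x) integrable_on cbox a b" if "p \<in> C_inf a b" for p
    by (intro integrable_continuous continuous_intros smooth_continuous C_infD(1)[OF d] C_infD(1)[OF that])
  have "integral (cbox a b) (\<lambda>x. d x * d x) = integral (cbox a b) (\<lambda>x. f x * d x - g x * d x)"
    by (simp add: d_def algebra_simps)
  also have "\<dots> = 0"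
    using eq[OF d] by (simp add: integral_diff int f g)
  finally have "d = (\<lambda>x. 0)" using integral_square_eq_0[OF box d] by blast
  then have "d x = 0" for x by simp
  then show ?thesis by (auto simp: d_def)
qed

text \<open>Derivatives are unique, so two candidates have equal integrals against every test
  function. This justifies the \<open>THE\<close> in \<open>first_variation\<close>.\<close>

lemma first_variation_unique:
  fixes a b :: "'a::euclidean_space"
  assumes box: "\<And>i. i \<in> Basis \<Longrightarrow> a \<bullet> i < b \<bullet> i"
    and "has_first_variation a b E u \<xi>"
  shows "first_variation a b E u = \<xi>"
proof -
  have "\<zeta> = \<xi>" if "has_first_variation a b E u \<zeta>" for \<zeta>
    using assms(2) that unfolding has_first_variation_def
    by (intro integral_test_eq[OF box]) (auto intro: DERIV_unique)
  then show ?thesis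
    unfolding first_variation_def using assms(2) by blast
qed

section \<open>Maximum principle\<close>

text \<open>If \<open>c\<close> were positive, \<open>w'\<close> would be positive just to the right
  of its zero at 0, and \<open>w\<close> would rise above its maximum.\<close>

lemma second_derivative_at_max:
  fixes w :: "real \<Rightarrow> real"
  assumes w: "\<And>t. (w has_real_derivative w' t) (at t)"
    and w': "(w' has_real_derivative c) (at 0)"
    and max: "\<And>t. w t \<le> w 0"
  shows "w' 0 = 0" "c \<le> 0"
proof -
  show 0: "w' 0 = 0"
    using DERIV_local_max[OF w[of 0], of 1] max by simp
  show "c \<le> 0"
  proof (rule ccontr)
    assume "\<not> c \<le> 0"
    then obtain d where d: "d > 0" "\<And>h. 0 < h \<Longrightarrow> h < d \<Longrightarrow> w' 0 < w' (0 + h)"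
      using DERIV_pos_inc_right[OF w'] by auto
    have "w 0 < w (d / 2)"
    proof (rule DERIV_pos_imp_increasing_open[of 0 "d / 2" w])
      show "0 < d / 2" using d by simp
      show "\<exists>y. (w has_real_derivative y) (at x) \<and> 0 < y" if "0 < x" "x < d / 2" for x
        using w[of x] d(2)[of x] that 0 d(1) by auto
      show "continuous_on {0..d / 2} w"
        using w by (meson DERIV_continuous_on has_field_derivative_at_within)
    qed
    then show False using max[of "d / 2"] by simp
  qed
qed

lemma directional_derivative:
  assumes "f differentiable (at (x + t *\<^sub>R i))"
  shows "((\<lambda>t. f (x + t *\<^sub>R i)) has_real_derivative partial i f (x + t *\<^sub>R i)) (at t)"
proof -
  let ?D = "frechet_derivative f (at (x + t *\<^sub>R i))"
  have "((\<lambda>t. x + t *\<^sub>R i) has_derivative (\<lambda>h. h *\<^sub>R i)) (at t)"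
    by (auto intro!: derivative_eq_intros)
  from has_derivative_compose[OF this partial_has_derivative[OF assms]]
  have "((\<lambda>t. f (x + t *\<^sub>R i)) has_derivative (\<lambda>h. ?D (h *\<^sub>R i))) (at t)" .
  moreover have "?D (h *\<^sub>R i) = partial i f (x + t *\<^sub>R i) * h" for h
    using linear_scale[OF linear_frechet_derivative[OF assms]] by (simp add: partial_def)
  ultimately show ?thesis by (simp add: has_field_derivative_def)
qed

lemma div_field_scaled_grad:
  "div_field (\<lambda>y. c y *\<^sub>R grad \<phi> y) x = (\<Sum>i\<in>Basis. partial i (\<lambda>y. c y * partial i \<phi> y) x)"
proof -
  have "grad \<phi> y \<bullet> i = partial i \<phi> y" if "i \<in> Basis" for y i
    using that by (simp add: grad_def inner_sum_left inner_Basis if_distrib cong: if_cong)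
  then show ?thesis by (simp add: div_field_def)
qed

text \<open>By the product rule each summand is a multiple of a first derivative, which vanishes at
  the maximum, plus \<open>c\<close> times a pure second derivative, which is nonpositive along each
  coordinate line.\<close>

lemma div_field_at_max:
  assumes w: "smooth w" and c: "smooth c" "\<And>y. 0 < c y" and max: "\<And>y. w y \<le> w x"
  shows "div_field (\<lambda>y. c y *\<^sub>R grad w y) x \<le> 0"
  unfolding div_field_scaled_grad
proof (rule sum_nonpos)
  fix i :: 'a assume i: "i \<in> Basis"
  have d: "((\<lambda>t. w (x + t *\<^sub>R i)) has_real_derivative partial i w (x + t *\<^sub>R i)) (at t)" for t
    by (intro directional_derivative smooth_differentiable w)
  have d2: "((\<lambda>t. partial i w (x + t *\<^sub>R i)) has_real_derivative partial i (partial i w) (x + 0 *\<^sub>R i)) (at 0)"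
    by (intro directional_derivative smooth_differentiable smooth_partial w i)
  have "partial i w x = 0" "partial i (partial i w) x \<le> 0"
    using second_derivative_at_max[OF d d2] max by auto
  moreover have "partial i (\<lambda>y. c y * partial i w y) x
      = partial i c x * partial i w x + c x * partial i (partial i w) x"
    by (intro partial_mult smooth_differentiable smooth_partial w c i)
  ultimately show "partial i (\<lambda>y. c y * partial i w y) x \<le> 0"
    using c(2)[of x] by (simp add: mult_nonneg_nonpos)
qed

text \<open>Compactness gives a maximum over the box, and periodicity makes it global.\<close>

lemma C_inf_attains_max:
  fixes a b :: "'a::euclidean_space"
  assumes box: "\<And>i. i \<in> Basis \<Longrightarrow> a \<bullet> i < b \<bullet> i" and f: "f \<in> C_inf a b"
  obtains x where "\<And>y. f y \<le> f x"
proof -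
  have "cbox a b \<noteq> {}" using box by (simp add: box_ne_empty less_imp_le)
  then obtain x where x: "\<And>y. y \<in> cbox a b \<Longrightarrow> f y \<le> f x"
    using continuous_attains_sup[OF compact_cbox _ smooth_continuous[OF C_infD(1)[OF f]]] by metis
  have "f y \<le> f x" for y
    using fundamental_domain[OF box, of y] x f by metis
  then show ?thesis using that by blast
qed

text \<open>Uniqueness for the elliptic equation is a maximum principle: at a maximum of a difference
  \<open>w\<close> of two solutions the divergence term is nonpositive, and it equals \<open>V2 * w\<close>.\<close>

lemma mf_operator_le:
  fixes a b :: "'a::euclidean_space"
  assumes box: "\<And>i. i \<in> Basis \<Longrightarrow> a \<bullet> i < b \<bullet> i"
    and c: "(\<lambda>x. V1 (u x)) \<in> C_inf a b" "\<And>x. 0 < V1 (u x)" and V2: "\<And>x. 0 < V2 (u x)"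
    and \<phi>: "\<phi> \<in> C_inf a b" and \<psi>: "\<psi> \<in> C_inf a b"
    and eq: "mf_operator V1 V2 u \<phi> = mf_operator V1 V2 u \<psi>"
  shows "\<phi> x \<le> \<psi> x"
proof -
  define w where "w y = \<phi> y - \<psi> y" for y
  have w: "w \<in> C_inf a b" unfolding w_def by (rule C_inf_diff[OF \<phi> \<psi>])
  note [intro] = smooth_differentiable smooth_partial smooth_mult C_infD(1)
  obtain x0 where x0: "\<And>y. w y \<le> w x0" using C_inf_attains_max[OF box w] by blast
  \<comment> \<open>Written as a sum, \<open>\<phi>\<close> lets additivity of partial derivatives
    split the divergence term.\<close>
  have \<phi>w: "\<phi> = (\<lambda>y. \<psi> y + w y)" by (simp add: w_def)
  have "div_field (\<lambda>y. V1 (u y) *\<^sub>R grad \<phi> y) x0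
      = div_field (\<lambda>y. V1 (u y) *\<^sub>R grad \<psi> y) x0 + div_field (\<lambda>y. V1 (u y) *\<^sub>R grad w y) x0"
    unfolding div_field_scaled_grad sum.distrib[symmetric]
  proof (rule sum.cong)
    fix i :: 'a assume i: "i \<in> Basis"
    have "partial i \<phi> y = partial i \<psi> y + partial i w y" for y
      unfolding \<phi>w using w \<psi> by (intro partial_add) auto
    then have "partial i (\<lambda>y. V1 (u y) * partial i \<phi> y) x0
        = partial i (\<lambda>y. V1 (u y) * partial i \<psi> y + V1 (u y) * partial i w y) x0"
      by (simp add: distrib_left)
    also have "\<dots> = partial i (\<lambda>y. V1 (u y) * partial i \<psi> y) x0
        + partial i (\<lambda>y. V1 (u y) * partial i w y) x0"
      using w \<psi> c(1) i by (intro partial_add smooth_differentiable smooth_mult smooth_partial C_infD(1))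
    finally show "partial i (\<lambda>y. V1 (u y) * partial i \<phi> y) x0
        = partial i (\<lambda>y. V1 (u y) * partial i \<psi> y) x0
          + partial i (\<lambda>y. V1 (u y) * partial i w y) x0" .
  qed simp
  moreover have "div_field (\<lambda>y. V1 (u y) *\<^sub>R grad w y) x0 \<le> 0"
    using div_field_at_max[OF C_infD(1)[OF w] C_infD(1)[OF c(1)] c(2) x0] .
  moreover have "mf_operator V1 V2 u \<phi> x0 = mf_operator V1 V2 u \<psi> x0" using eq by simp
  ultimately have "V2 (u x0) * w x0 \<le> 0"
    by (simp add: mf_operator_def w_def algebra_simps)
  then have "w x0 \<le> 0" using V2[of x0] by (simp add: mult_le_0_iff)
  then show ?thesis using x0[of x] by (simp add: w_def)
qed

section \<open>The gradient in the mean-field metric\<close>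

lemma mf_operator_C_inf:
  assumes "(\<lambda>x. V1 (u x)) \<in> C_inf a b" "(\<lambda>x. V2 (u x)) \<in> C_inf a b" "\<phi> \<in> C_inf a b"
  shows "mf_operator V1 V2 u \<phi> \<in> C_inf a b"
proof -
  have "mf_operator V1 V2 u \<phi>
      = (\<lambda>x. V2 (u x) * \<phi> x - (\<Sum>i\<in>Basis. partial i (\<lambda>y. V1 (u y) * partial i \<phi> y) x))"
    by (simp add: mf_operator_def div_field_scaled_grad fun_eq_iff)
  then show ?thesis
    using assms by (auto intro!: C_inf_diff C_inf_mult C_inf_sum C_inf_partial)
qed

text \<open>Solvability of the elliptic equation enters only for the right-hand side
  \<open>h\<close>: forwards it is contained in the metric being \<open>Some\<close>, backwards the
  first variation is a solution.\<close>

lemma is_mf_gradient_iff: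
  fixes a b :: "'a::euclidean_space"
  assumes box: "\<And>i. i \<in> Basis \<Longrightarrow> a \<bullet> i < b \<bullet> i"
    and c: "(\<lambda>x. V1 (u x)) \<in> C_inf a b" "\<And>x. 0 < V1 (u x)"
    and V2: "(\<lambda>x. V2 (u x)) \<in> C_inf a b" "\<And>x. 0 < V2 (u x)"
    and \<xi>: "first_variation a b E u \<in> C_inf a b"
  shows "is_mf_gradient a b V1 V2 E u h \<longleftrightarrow> h = mf_operator V1 V2 u (first_variation a b E u)"
proof
  let ?\<xi> = "first_variation a b E u"
  let ?P = "\<lambda>h \<phi>. \<phi> \<in> C_inf a b \<and> mf_operator V1 V2 u \<phi> = h"
  {
    assume "is_mf_gradient a b V1 V2 E u h"
    then have m: "\<And>\<sigma>. \<sigma> \<in> C_inf a b \<Longrightarrow> mf_metric a b V1 V2 u \<sigma> h =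
        Some (integral (cbox a b) (\<lambda>x. ?\<xi> x * \<sigma> x))"
      by (simp add: is_mf_gradient_def)
    \<comment> \<open>One test function, here the first variation itself, already shows that the
      inverse is defined at \<open>h\<close>.\<close>
    then obtain \<phi> where \<phi>: "mf_inverse a b V1 V2 u h = Some \<phi>"
      using \<xi> by (fastforce simp: mf_metric_def)
    then have ex: "\<exists>!\<phi>. ?P h \<phi>" and "\<phi> = (THE \<phi>. ?P h \<phi>)"
      by (auto simp: mf_inverse_def split: if_splits)
    then have P: "?P h \<phi>" using theI'[OF ex] by simp
    have "\<phi> = ?\<xi>"
      using m \<phi> P by (intro integral_test_eq[OF box _ \<xi>]) (auto simp: mf_metric_def mult.commute)
    then show "h = mf_operator V1 V2 u ?\<xi>" using P by simp
  next
    assume h: "h = mf_operator V1 V2 u ?\<xi>"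
    note le = mf_operator_le[where ?V1.0 = V1 and ?V2.0 = V2 and u = u, OF box c V2(2)]
    \<comment> \<open>The comparison is one-sided, so it is applied in both orders.\<close>
    have uniq: "\<phi> = ?\<xi>" if "?P h \<phi>" for \<phi>
      using that h le[of \<phi> ?\<xi>] le[of ?\<xi> \<phi>] \<xi>
      by (auto intro!: antisym simp: le_fun_def)
    have P: "?P h ?\<xi>" using h \<xi> by simp
    have "\<exists>!\<phi>. ?P h \<phi>" using P uniq by (rule ex1I[of "?P h"])
    moreover have "(THE \<phi>. ?P h \<phi>) = ?\<xi>" using P uniq by (rule the_equality[of "?P h"])
    ultimately have "mf_inverse a b V1 V2 u h = Some ?\<xi>" by (simp add: mf_inverse_def)
    moreover have "h \<in> C_inf a b" unfolding h by (rule mf_operator_C_inf[OF c(1) V2(1) \<xi>])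
    ultimately show "is_mf_gradient a b V1 V2 E u h"
      by (simp add: is_mf_gradient_def mf_metric_def mult.commute)
  }
qed

section \<open>First variation of the integral of \<open>G\<close>\<close>

text \<open>By compactness and periodicity \<open>u\<close> has a positive minimum and
  \<open>\<sigma>\<close> is bounded, so small multiples of \<open>\<sigma>\<close> cannot destroy
  positivity.\<close>

lemma density_space_perturb:
  fixes a b :: "'a::euclidean_space"
  assumes box: "\<And>i. i \<in> Basis \<Longrightarrow> a \<bullet> i < b \<bullet> i"
    and u: "u \<in> density_space a b" and \<sigma>: "\<sigma> \<in> C_inf a b"
  obtains d where "d > 0" "\<And>e. \<bar>e\<bar> < d \<Longrightarrow> (\<lambda>x. u x + e * \<sigma> x) \<in> density_space a b"
proof -
  note uD = density_spaceD[OF u]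
  have mem: "(\<lambda>x. u x + e * \<sigma> x) \<in> C_inf a b" for e
    by (intro C_inf_add C_inf_mult C_inf_const uD \<sigma>)
  \<comment> \<open>The square is smooth, while the absolute value need not be; both are maximal at
    the same points.\<close>
  obtain xs where xs: "\<And>y. \<sigma> y * \<sigma> y \<le> \<sigma> xs * \<sigma> xs"
    using C_inf_attains_max[OF box C_inf_mult[OF \<sigma> \<sigma>]] by blast
  have s: "\<bar>\<sigma> y\<bar> \<le> \<bar>\<sigma> xs\<bar>" for y
    using xs[of y] by (simp add: abs_le_square_iff power2_eq_square)
  have "u x \<noteq> 0" for x using uD(2)[of x] by simp
  \<comment> \<open>A maximum point of the reciprocal is a minimum point of
    \<open>u\<close>.\<close>
  then obtain xu where xu: "\<And>y. inverse (u y) \<le> inverse (u xu)"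
    using C_inf_attains_max[OF box C_inf_inverse[OF uD(1)]] by blast
  have u_min: "u xu \<le> u y" for y
    using inverse_le_imp_le[OF xu uD(2)] .
  \<comment> \<open>Adding 1 keeps the denominator positive when \<open>\<sigma>\<close> is
    zero.\<close>
  define d where "d = u xu / (\<bar>\<sigma> xs\<bar> + 1)"
  have "d > 0" using uD(2) by (simp add: d_def)
  moreover have "(\<lambda>x. u x + e * \<sigma> x) \<in> density_space a b" if "\<bar>e\<bar> < d" for e
  proof -
    have "0 < u y + e * \<sigma> y" for y
    proof -
      have "\<bar>e * \<sigma> y\<bar> \<le> \<bar>e\<bar> * (\<bar>\<sigma> xs\<bar> + 1)"
        unfolding abs_mult using s[of y] by (intro mult_left_mono) auto
      also have "\<dots> < d * (\<bar>\<sigma> xs\<bar> + 1)" using that by (intro mult_strict_right_mono) auto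
      also have "\<dots> = u xu" by (simp add: d_def)
      finally show ?thesis using u_min[of y] by linarith
    qed
    then show ?thesis using mem by (simp add: density_space_def)
  qed
  ultimately show ?thesis using that by blast
qed

text \<open>Differentiation under the integral sign, for \<open>e\<close> in an interval around 0 on
  which the perturbed density stays positive.\<close>

lemma first_variation_integral:
  fixes a b :: "'a::euclidean_space"
  assumes box: "\<And>i. i \<in> Basis \<Longrightarrow> a \<bullet> i < b \<bullet> i" and G: "smooth_pos G"
    and E: "\<And>v. v \<in> density_space a b \<Longrightarrow> E v = integral (cbox a b) (\<lambda>x. G (v x))"
    and u: "u \<in> density_space a b"
  shows "has_first_variation a b E u (\<lambda>x. deriv G (u x))"
  unfolding has_first_variation_def
proof (intro conjI ballI)
  show "(\<lambda>x. deriv G (u x)) \<in> C_inf a b"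
    by (rule C_inf_compose[OF smooth_pos_deriv[OF G] u])
  fix \<sigma> :: "'a \<Rightarrow> real" assume \<sigma>: "\<sigma> \<in> C_inf a b"
  obtain d where d: "d > 0" "\<And>e. \<bar>e\<bar> < d \<Longrightarrow> (\<lambda>x. u x + e * \<sigma> x) \<in> density_space a b"
    using density_space_perturb[OF box u \<sigma>] by blast
  \<comment> \<open>\<open>U\<close> is convex, as the Leibniz rule requires, and open, so that the
    derivative at 0 within \<open>U\<close> is the full derivative.\<close>
  define U where "U = {- d<..<d}"
  have U: "(\<lambda>x. u x + e * \<sigma> x) \<in> density_space a b" if "e \<in> U" for e
    using d(2)[of e] that by (auto simp: U_def)
  have pos: "u x + e * \<sigma> x > 0" if "e \<in> U" for e x
    using density_spaceD(2)[OF U[OF that]] .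
  have "((\<lambda>e. integral (cbox a b) (\<lambda>x. G (u x + e * \<sigma> x))) has_field_derivative
      integral (cbox a b) (\<lambda>x. deriv G (u x + 0 * \<sigma> x) * \<sigma> x)) (at 0 within U)"
  proof (rule leibniz_rule_field_derivative)
    fix e x assume e: "e \<in> U"
    have "(G has_real_derivative deriv G (u x + e * \<sigma> x)) (at (u x + e * \<sigma> x))"
      using smooth_pos_differentiable[OF G pos[OF e]] DERIV_deriv_iff_real_differentiable by blast
    moreover have "((\<lambda>e. u x + e * \<sigma> x) has_real_derivative \<sigma> x) (at e within U)"
      by (auto intro!: derivative_eq_intros)
    ultimately show "((\<lambda>e. G (u x + e * \<sigma> x)) has_real_derivative deriv G (u x + e * \<sigma> x) * \<sigma> x) (at e within U)"
      by (rule DERIV_chain2)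
  next
    fix e assume "e \<in> U"
    then show "(\<lambda>x. G (u x + e * \<sigma> x)) integrable_on cbox a b"
      by (intro integrable_continuous smooth_continuous C_infD(1)[OF C_inf_compose[OF G U]])
  next
    \<comment> \<open>\<open>G\<close> is controlled only on the positive reals; \<open>pos\<close>
      keeps the argument of \<open>deriv G\<close> there.\<close>
    have dG: "continuous_on {0<..} (deriv G)"
      using smooth_pos_differentiable[OF smooth_pos_deriv[OF G]]
      by (auto intro!: continuous_at_imp_continuous_on differentiable_imp_continuous_within)
    have snd: "continuous_on (U \<times> cbox a b) (\<lambda>p. f (snd p))" if "f \<in> C_inf a b" for f :: "'a \<Rightarrow> real"
      using continuous_on_compose2[OF smooth_continuous[OF C_infD(1)[OF that]] continuous_on_snd[OF continuous_on_id]]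
      by blast
    show "continuous_on (U \<times> cbox a b) (\<lambda>(e, x). deriv G (u x + e * \<sigma> x) * \<sigma> x)"
      unfolding case_prod_beta
      by (intro continuous_intros continuous_on_compose2[OF dG] snd \<sigma> density_spaceD(1)[OF u])
        (use pos in auto)
  qed (use d(1) in \<open>auto simp: U_def\<close>)
  moreover have oU: "open U" "0 \<in> U" using d(1) by (auto simp: U_def)
  ultimately have "((\<lambda>e. integral (cbox a b) (\<lambda>x. G (u x + e * \<sigma> x))) has_field_derivative
      integral (cbox a b) (\<lambda>x. deriv G (u x) * \<sigma> x)) (at 0)"
    by (simp only: at_within_open[OF oU(2,1)] mult_zero_left add_0_right)
  \<comment> \<open>\<open>E\<close> is known to be the integral only on the density space;
    agreement for all \<open>e\<close> in the open set \<open>U\<close> suffices for the derivative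
    at 0.\<close>
  then show "((\<lambda>e. E (\<lambda>x. u x + e * \<sigma> x)) has_real_derivative
      integral (cbox a b) (\<lambda>x. deriv G (u x) * \<sigma> x)) (at 0)"
    by (rule has_field_derivative_transform_within_open[OF _ oU]) (rule E[OF U, symmetric])
qed

section \<open>Reaction-diffusion form and conclusion\<close>

text \<open>The two fluxes agree before the divergence is taken: by the chain rule both are
  \<open>deriv F (u y)\<close> times the gradient of \<open>u\<close>.\<close>

lemma div_field_chain:
  assumes F: "smooth_pos F" and G: "smooth_pos G" and u: "u \<in> density_space a b"
    and V1: "\<And>r. r > 0 \<Longrightarrow> V1 r * deriv (deriv G) r = deriv F r"
  shows "div_field (\<lambda>y. V1 (u y) *\<^sub>R grad (\<lambda>y. deriv G (u y)) y) x = laplacian (\<lambda>y. F (u y)) x"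
proof -
  note uD = C_infD(1)[OF density_spaceD(1)[OF u]] density_spaceD(2)[OF u]
  have chain: "partial i (\<lambda>y. h (u y)) y = deriv h (u y) * partial i u y" if "smooth_pos h" for h i y
    using partial_compose[of h u] smooth_pos_differentiable[OF that uD(2)] smooth_differentiable[OF uD(1)]
    by blast
  \<comment> \<open>The factor 1 presents the Laplacian as a divergence with constant coefficient,
    the form of \<open>div_field_scaled_grad\<close>.\<close>
  have "V1 (u y) * partial i (\<lambda>y. deriv G (u y)) y = 1 * partial i (\<lambda>y. F (u y)) y" for i y
    unfolding chain[OF smooth_pos_deriv[OF G]] chain[OF F] V1[OF uD(2), symmetric] by simp
  then show ?thesis
    unfolding laplacian_def
    using div_field_scaled_grad[of "\<lambda>y. 1" "\<lambda>y. F (u y)" x] by (simp add: div_field_scaled_grad)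
qed

theorem proposition3:
  fixes a b :: "'a::euclidean_space"
    and F G R V1 V2 :: "real \<Rightarrow> real"
    and E :: "('a \<Rightarrow> real) \<Rightarrow> real"
    and I :: "real set"
    and u :: "real \<Rightarrow> 'a \<Rightarrow> real"
  assumes box: "\<And>i. i \<in> Basis \<Longrightarrow> a \<bullet> i < b \<bullet> i"
    and smooth: "smooth_pos F" "smooth_pos G" "smooth_pos R" "smooth_pos V2"
    and F': "\<And>r. r > 0 \<Longrightarrow> deriv F r > 0"
    and G'': "\<And>r. r > 0 \<Longrightarrow> deriv (deriv G) r > 0"
    and V1: "\<And>r. r > 0 \<Longrightarrow> V1 r = deriv F r / deriv (deriv G) r"
    and V2_pos: "\<And>r. r > 0 \<Longrightarrow> V2 r > 0"
    and V2: "\<And>r. r > 0 \<Longrightarrow> V2 r * deriv G r = - R r"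
    and E: "\<And>v. v \<in> density_space a b \<Longrightarrow> \<exists>\<xi>. has_first_variation a b E v \<xi>"
    and curve: "\<And>t. t \<in> I \<Longrightarrow> u t \<in> density_space a b"
  shows
    "(\<forall>t\<in>I. gradient_flow_at a b V1 V2 E I u t \<longleftrightarrow>
        (\<forall>x. ((\<lambda>s. u s x) has_real_derivative
           (div_field (\<lambda>y. V1 (u t y) *\<^sub>R grad (first_variation a b E (u t)) y) x
             - V2 (u t x) * first_variation a b E (u t) x)) (at t within I))) \<and>
     ((\<forall>v\<in>density_space a b. E v = integral (cbox a b) (\<lambda>x. G (v x))) \<longrightarrow>
      (\<forall>t\<in>I. (\<forall>x. ((\<lambda>s. u s x) has_real_derivative
           (div_field (\<lambda>y. V1 (u t y) *\<^sub>R grad (first_variation a b E (u t)) y) x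
             - V2 (u t x) * first_variation a b E (u t) x)) (at t within I)) \<longleftrightarrow>
        (\<forall>x. ((\<lambda>s. u s x) has_real_derivative
           (laplacian (\<lambda>y. F (u t y)) x + R (u t x))) (at t within I))))"
proof -
  have V1_eq: "V1 r * deriv (deriv G) r = deriv F r" "0 < V1 r" if "r > 0" for r
    using V1[OF that] G''[OF that] F'[OF that] by simp_all
  have main: "gradient_flow_at a b V1 V2 E I u t \<longleftrightarrow>
        (\<forall>x. ((\<lambda>s. u s x) has_real_derivative
           (div_field (\<lambda>y. V1 (u t y) *\<^sub>R grad (first_variation a b E (u t)) y) x
             - V2 (u t x) * first_variation a b E (u t) x)) (at t within I))" if t: "t \<in> I" for t
  proof -
    note ut = curve[OF t]
    note pos = density_spaceD(2)[OF ut]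
    obtain \<xi> where \<xi>: "has_first_variation a b E (u t) \<xi>" using E[OF ut] by blast
    then have fv: "first_variation a b E (u t) \<in> C_inf a b"
      using first_variation_unique[OF box \<xi>] by (simp add: has_first_variation_def)
    note comp = C_inf_compose[OF _ ut]
    \<comment> \<open>\<open>V1\<close> is given by a quotient on the positive reals; smoothness of
      its composition with \<open>u t\<close> comes from the factors of that quotient.\<close>
    have "(\<lambda>x. V1 (u t x)) = (\<lambda>x. deriv F (u t x) * inverse (deriv (deriv G) (u t x)))"
      using V1[OF pos] by (simp add: divide_inverse)
    moreover have "deriv (deriv G) (u t x) \<noteq> 0" for x using G''[OF pos, of x] by simp
    ultimately have c: "(\<lambda>x. V1 (u t x)) \<in> C_inf a b"
      using C_inf_mult[OF comp[OF smooth_pos_deriv] C_inf_inverse[OF comp[OF smooth_pos_deriv[OF smooth_pos_deriv]]]]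
        smooth(1,2) by metis
    have "is_mf_gradient a b V1 V2 E (u t) h \<longleftrightarrow>
        h = mf_operator V1 V2 (u t) (first_variation a b E (u t))" for h
      by (rule is_mf_gradient_iff[where ?V1.0 = V1 and ?V2.0 = V2 and u = "u t",
            OF box c V1_eq(2)[OF pos] comp[OF smooth(4)] V2_pos[OF pos] fv])
    \<comment> \<open>Since \<open>h\<close> is determined uniquely, the existential in the flow
      collapses to the single velocity \<open>- h\<close>.\<close>
    then show ?thesis by (simp add: gradient_flow_at_def mf_operator_def)
  qed
  \<comment> \<open>The two velocities coincide pointwise, so the two evolution equations become the
    same statement.\<close>
  have "div_field (\<lambda>y. V1 (u t y) *\<^sub>R grad (first_variation a b E (u t)) y) x
      - V2 (u t x) * first_variation a b E (u t) x = laplacian (\<lambda>y. F (u t y)) x + R (u t x)"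
    if "\<forall>v\<in>density_space a b. E v = integral (cbox a b) (\<lambda>x. G (v x))" "t \<in> I" for t x
  proof -
    note ut = curve[OF that(2)]
    have "first_variation a b E (u t) = (\<lambda>x. deriv G (u t x))"
      by (intro first_variation_unique[OF box] first_variation_integral[OF box smooth(2) _ ut])
        (use that(1) in auto)
    then show ?thesis
      using div_field_chain[OF smooth(1,2) ut V1_eq(1), of x] V2[OF density_spaceD(2)[OF ut], of x]
      by simp
  qed
  then show ?thesis using main by simp
qed

end
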